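(* Let $\rho$, $\phi$ be the solution to the system $$\left\{\begin{aligned} &\partial_t\rho(t,x) + \nabla_x\cdot \left(\rho(t,x)\, \mathrm{D}_p H(t,x,\nabla_x\phi(t,x))\right)=\frac1\beta \Delta_x \rho(t,x),\\ &\partial_t\phi(t,x)+H(t,x,\nabla_x\phi(t,x))+\frac1\beta \Delta_x\phi(t,x) = f(t,x,\rho(t,x)),\\ & \rho(0,x)=\rho_0(x),\quad \phi(T,x)=-V(x), \end{aligned}\right.$$ on $[0,T]\times\mathbb{R}^d$. Let $x_t$ be the probability flow defined by $$\partial_t x_t = \mathrm{D}_p H(t,x_t,\nabla_x\phi(t,x_t)) - \frac1\beta \nabla_x \log \rho(t,x_t),$$ with $x_0\sim\rho_0$, and let $y_t = \phi(t,x_t)$. Then $x_t$ and $y_t$ satisfy the forward-backward ODE system $$\left\{ \begin{aligned} \partial_t x_t &= \mathrm{D}_p H(t,x_t,z_t) - \frac1\beta \nabla_x \log \rho(t,x_t),\\ \partial_t y_t &= L(t,x_t,\mathrm{D}_p H(t,x_t,z_t)) + f_t - \frac1\beta h_t - \frac1\beta z_t^{\top} \nabla_x \log \rho(t,x_t), \end{aligned} \right.$$ with initial condition $x_0 \sim \rho_0$ and terminal condition $y_T = -V(x_T)$, where $f_t=f(t,x_t,\rho(t,x_t))$, $z_t = \nabla_x \phi(t,x_t)$, and $h_t = \Delta_x \phi(t,x_t)$.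
   Context: Here $T>0$ is the time horizon, $d$ is the space dimension, and $1/\beta>0$ is a constant diffusion coefficient. $L\colon \mathbb{R} \times \mathbb{R}^d \times \mathbb{R}^d \to \mathbb{R}$ is the Lagrangian, with $L(t,x,v)$ assumed strongly convex in $v$. $F\colon \mathbb{R} \times \mathbb{R}^d \times \mathbb{R} \to \mathbb{R}$ is a running cost, $f(t,x,\rho)=\frac{\partial F}{\partial\rho}(t,x,\rho)$ is its partial derivative in the third argument, $V \colon \mathbb{R}^d \to \mathbb{R}$ is the terminal energy, and $\rho_0\colon\mathbb{R}^d\to\mathbb{R}$ is a given probability density. The Hamiltonian is the Legendre transform of the Lagrangian, $$H(t,x,p) = \sup_{v \in \mathbb{R}^d} \left( v^{\top} p - L(t,x,v)\right);$$ $\mathrm{D}_p H$ denotes its gradient with respect to $p$, and the supremum is attained at $v^*=\mathrm{D}_pH(t,x,p)$. The notation $x_0\sim\rho_0$ means that the initial point is random with density $\rho_0$; it is the only source of randomness. *)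

theory Defs
  imports "HOL-Probability.Probability"
begin

definition grad :: "('a::euclidean_space \<Rightarrow> real) \<Rightarrow> 'a \<Rightarrow> 'a" where
  "grad u x = (THE D. GDERIV u x :> D)"

definition divergence :: "('a::euclidean_space \<Rightarrow> 'a) \<Rightarrow> 'a \<Rightarrow> real" where
  "divergence G x = (\<Sum>e\<in>Basis. frechet_derivative G (at x) e \<bullet> e)"

definition laplacian :: "('a::euclidean_space \<Rightarrow> real) \<Rightarrow> 'a \<Rightarrow> real" where
  "laplacian u = divergence (grad u)"

(* One-sided at the end points 0 and T. *)
definition time_deriv :: "real \<Rightarrow> (real \<Rightarrow> 'a \<Rightarrow> real) \<Rightarrow> real \<Rightarrow> 'a \<Rightarrow> real" where
  "time_deriv T u t x = vector_derivative (\<lambda>s. u s x) (at t within {0..T})"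

(* The class C^{1,2} on [0,T] x R^d, up to the end points of the time interval. *)
definition C12 :: "real \<Rightarrow> (real \<Rightarrow> 'a::euclidean_space \<Rightarrow> real) \<Rightarrow> bool" where
  "C12 T u \<longleftrightarrow>
     (\<forall>t\<in>{0..T}. \<forall>x. (\<lambda>s. u s x) differentiable (at t within {0..T})
                   \<and> u t differentiable (at x)
                   \<and> grad (u t) differentiable (at x))
   \<and> continuous_on ({0..T} \<times> UNIV) (\<lambda>(t, x). u t x)
   \<and> continuous_on ({0..T} \<times> UNIV) (\<lambda>(t, x). time_deriv T u t x)
   \<and> continuous_on ({0..T} \<times> UNIV) (\<lambda>(t, x). grad (u t) x)
   \<and> (\<forall>e\<in>Basis. continuous_on ({0..T} \<times> UNIV)
                    (\<lambda>(t, x). frechet_derivative (grad (u t)) (at x) e))"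

definition strongly_convex :: "('a::real_inner \<Rightarrow> real) \<Rightarrow> bool" where
  "strongly_convex g \<longleftrightarrow>
     (\<exists>\<mu>>0. \<forall>v w. \<forall>s\<in>{0..1}.
        g (s *\<^sub>R v + (1 - s) *\<^sub>R w)
          \<le> s * g v + (1 - s) * g w - \<mu> / 2 * s * (1 - s) * (norm (v - w))\<^sup>2)"

(* The supremum is over the reals; it is finite when L t x is strongly convex. *)
definition hamiltonian ::
  "(real \<Rightarrow> 'a::euclidean_space \<Rightarrow> 'a \<Rightarrow> real) \<Rightarrow> real \<Rightarrow> 'a \<Rightarrow> 'a \<Rightarrow> real" where
  "hamiltonian L t x p = (SUP v. v \<bullet> p - L t x v)"

definition DpH ::
  "(real \<Rightarrow> 'a::euclidean_space \<Rightarrow> 'a \<Rightarrow> real) \<Rightarrow> real \<Rightarrow> 'a \<Rightarrow> 'a \<Rightarrow> 'a" where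
  "DpH L t x p = grad (hamiltonian L t x) p"

(* Classical solutions. Differentiability of the flux gives its divergence a meaning. *)
definition mfg_solution ::
  "real \<Rightarrow> real \<Rightarrow> (real \<Rightarrow> 'a::euclidean_space \<Rightarrow> 'a \<Rightarrow> real) \<Rightarrow> (real \<Rightarrow> 'a \<Rightarrow> real \<Rightarrow> real)
     \<Rightarrow> ('a \<Rightarrow> real) \<Rightarrow> ('a \<Rightarrow> real) \<Rightarrow> (real \<Rightarrow> 'a \<Rightarrow> real) \<Rightarrow> (real \<Rightarrow> 'a \<Rightarrow> real) \<Rightarrow> bool" where
  "mfg_solution T \<beta> L f V \<rho>0 \<rho> \<phi> \<longleftrightarrow>
     C12 T \<rho> \<and> C12 T \<phi>
   \<and> (\<forall>t\<in>{0..T}. \<forall>x. (\<lambda>\<xi>. \<rho> t \<xi> *\<^sub>R DpH L t \<xi> (grad (\<phi> t) \<xi>)) differentiable (at x))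
   \<and> (\<forall>t\<in>{0..T}. \<forall>x.
        time_deriv T \<rho> t x + divergence (\<lambda>\<xi>. \<rho> t \<xi> *\<^sub>R DpH L t \<xi> (grad (\<phi> t) \<xi>)) x
          = 1 / \<beta> * laplacian (\<rho> t) x)
   \<and> (\<forall>t\<in>{0..T}. \<forall>x.
        time_deriv T \<phi> t x + hamiltonian L t x (grad (\<phi> t) x) + 1 / \<beta> * laplacian (\<phi> t) x
          = f t x (\<rho> t x))
   \<and> (\<forall>x. \<rho> 0 x = \<rho>0 x) \<and> (\<forall>x. \<phi> T x = - V x)"

(* The second conjunct says that the initial point is the only source of randomness. *)
definition random_start ::
  "'w measure \<Rightarrow> real \<Rightarrow> ('a::euclidean_space \<Rightarrow> real) \<Rightarrow> (real \<Rightarrow> 'w \<Rightarrow> 'a) \<Rightarrow> bool" where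
  "random_start M T \<rho>0 X \<longleftrightarrow>
     distributed M lborel (X 0) (\<lambda>\<xi>. ennreal (\<rho>0 \<xi>))
   \<and> (\<exists>\<Phi>. \<forall>t\<in>{0..T}. \<forall>\<omega>\<in>space M. X t \<omega> = \<Phi> t (X 0 \<omega>))"

(* Positivity of the density along the path is what makes grad (ln rho) meaningful there. *)
definition probability_flow ::
  "'w measure \<Rightarrow> real \<Rightarrow> real \<Rightarrow> (real \<Rightarrow> 'a::euclidean_space \<Rightarrow> 'a \<Rightarrow> real)
     \<Rightarrow> ('a \<Rightarrow> real) \<Rightarrow> (real \<Rightarrow> 'a \<Rightarrow> real) \<Rightarrow> (real \<Rightarrow> 'a \<Rightarrow> real) \<Rightarrow> (real \<Rightarrow> 'w \<Rightarrow> 'a) \<Rightarrow> bool" where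
  "probability_flow M T \<beta> L \<rho>0 \<rho> \<phi> X \<longleftrightarrow>
     random_start M T \<rho>0 X
   \<and> (AE \<omega> in M. \<forall>t\<in>{0..T}.
        0 < \<rho> t (X t \<omega>)
      \<and> ((\<lambda>s. X s \<omega>) has_vector_derivative
           DpH L t (X t \<omega>) (grad (\<phi> t) (X t \<omega>))
             - (1 / \<beta>) *\<^sub>R grad (\<lambda>\<xi>. ln (\<rho> t \<xi>)) (X t \<omega>)) (at t within {0..T}))"

end

theory Submission
  imports Defs
begin

text \<open>
  The chain rule along a path gives \<open>y' = \<partial>\<^sub>t\<phi> + z \<bullet> x'\<close>; the Hamilton-Jacobi-Bellman equation
  replaces \<open>\<partial>\<^sub>t\<phi>\<close>, and the Legendre identity \<open>H(p) = D\<^sub>pH(p) \<bullet> p - L(D\<^sub>pH(p))\<close> turns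
  \<open>z \<bullet> D\<^sub>pH - H\<close> into \<open>L\<close>. The identity needs \<open>H\<close> to be differentiable with gradient the maximiser
  \<open>v\<close> of \<open>v \<bullet> p - L(v)\<close>: strong convexity makes this function decay quadratically away from \<open>v\<close>,
  so that \<open>0 \<le> H(q) - H(p) - v \<bullet> (q - p) \<le> C |q - p|\<^sup>2\<close>.
\<close>

section \<open>Gradients in Euclidean space\<close>

lemma grad_eqI:
  fixes u :: "'a::euclidean_space \<Rightarrow> real"
  assumes "GDERIV u x :> D"
  shows "grad u x = D"
  unfolding grad_def
proof (rule the_equality)
  show "GDERIV u x :> D" by (rule assms)
next
  fix E assume "GDERIV u x :> E"
  with assms have "(\<lambda>h. h \<bullet> E) = (\<lambda>h. h \<bullet> D)"
    unfolding gderiv_def by (intro has_derivative_unique)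
  then have "\<forall>h. h \<bullet> E = h \<bullet> D"
    by (rule fun_cong[THEN allI])
  then show "E = D"
    by (rule vector_eq_ldot[THEN iffD1])
qed

text \<open>Riesz representation: a linear functional on a Euclidean space is the inner product with
  the vector assembled from its values on the basis. This gives the existence half that the definite
  description in \<open>grad\<close> requires; \<open>grad_eqI\<close> gives uniqueness.\<close>

lemma GDERIV_grad:
  fixes u :: "'a::euclidean_space \<Rightarrow> real"
  assumes "u differentiable (at x)"
  shows "GDERIV u x :> grad u x"
proof -
  obtain u' where u': "(u has_derivative u') (at x)"
    using assms by (auto simp: differentiable_def)
  then interpret u': bounded_linear u'
    by (rule has_derivative_bounded_linear)
  have "u' = (\<lambda>h. h \<bullet> (\<Sum>e\<in>Basis. u' e *\<^sub>R e))"
  proof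
    fix h
    have "u' h = u' (\<Sum>e\<in>Basis. (h \<bullet> e) *\<^sub>R e)"
      by (simp add: euclidean_representation)
    also have "\<dots> = (\<Sum>e\<in>Basis. (h \<bullet> e) * u' e)"
      by (simp add: u'.sum u'.scaleR)
    finally show "u' h = h \<bullet> (\<Sum>e\<in>Basis. u' e *\<^sub>R e)"
      by (simp add: inner_sum_right mult.commute)
  qed
  with u' have "GDERIV u x :> (\<Sum>e\<in>Basis. u' e *\<^sub>R e)"
    unfolding gderiv_def by simp
  with grad_eqI show ?thesis by fastforce
qed

section \<open>Minimisers of strongly convex functions\<close>

lemma strongly_convex_imp_convex_on:
  assumes "strongly_convex g"
  shows "convex_on UNIV g"
proof (rule convex_onI)
  fix t x y assume t: "(0::real) < t" "t < 1"
  from assms obtain \<mu> where \<mu>: "\<mu> > 0" and "\<forall>v w. \<forall>s\<in>{0..1}.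
      g (s *\<^sub>R v + (1 - s) *\<^sub>R w) \<le> s * g v + (1 - s) * g w - \<mu> / 2 * s * (1 - s) * (norm (v - w))\<^sup>2"
    unfolding strongly_convex_def by blast
  from this(2)[rule_format, of t y x] t
  have "g (t *\<^sub>R y + (1 - t) *\<^sub>R x)
      \<le> t * g y + (1 - t) * g x - \<mu> / 2 * t * (1 - t) * (norm (y - x))\<^sup>2" by auto
  moreover have "0 \<le> \<mu> / 2 * t * (1 - t) * (norm (y - x))\<^sup>2"
    using \<mu> t by simp
  ultimately show "g ((1 - t) *\<^sub>R x + t *\<^sub>R y) \<le> (1 - t) * g x + t * g y"
    by (simp add: add.commute)
qed auto

text \<open>A linear term cancels from the defining inequality, so the same \<mu> works. Maximising
  \<open>v \<bullet> p - L t x v\<close> thereby becomes minimising a strongly convex function of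
  \<open>v\<close>.\<close>

lemma strongly_convex_diff_inner:
  assumes "strongly_convex g"
  shows "strongly_convex (\<lambda>v. g v - v \<bullet> p)"
  using assms unfolding strongly_convex_def
  by (simp add: inner_left_distrib algebra_simps)

text \<open>Coercivity and compactness: outside a large ball \<open>g\<close> is at least
  \<open>g 0\<close>, and on the ball a continuous function attains its minimum.\<close>

lemma strongly_convex_attains_min:
  fixes g :: "'a::euclidean_space \<Rightarrow> real"
  assumes "strongly_convex g"
  obtains v where "\<And>w. g v \<le> g w"
proof -
  \<comment> \<open>Continuity comes from convexity: a finite convex function on an open subset of a
    Euclidean space is continuous.\<close>
  have cont: "continuous_on UNIV g"
    by (rule convex_on_continuous[OF open_UNIV strongly_convex_imp_convex_on[OF assms]])
  from assms obtain \<mu> where \<mu>: "\<mu> > 0" and sc: "\<And>v w s. s \<in> {0..1} \<Longrightarrow>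
      g (s *\<^sub>R v + (1 - s) *\<^sub>R w) \<le> s * g v + (1 - s) * g w - \<mu> / 2 * s * (1 - s) * (norm (v - w))\<^sup>2"
    unfolding strongly_convex_def by blast
  obtain m where m: "\<And>v. v \<in> sphere 0 1 \<Longrightarrow> m \<le> g v"
  proof -
    have "bounded (g ` sphere 0 1)"
      by (intro compact_imp_bounded compact_continuous_image continuous_on_subset[OF cont]) auto
    then obtain B where "\<And>v. v \<in> sphere 0 1 \<Longrightarrow> \<bar>g v\<bar> \<le> B"
      unfolding bounded_iff by (metis imageI real_norm_def)
    then show ?thesis
      by (intro that[of "- B"]) (fastforce simp: abs_le_iff)
  qed
  \<comment> \<open>For \<open>norm v > R\<close> the unit vector along \<open>v\<close> is a convex
    combination of \<open>v\<close> and 0, and the gain \<open>\<mu> / 2 * (norm v - 1)\<close> from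
    strong convexity outweighs \<open>g 0 - m\<close>.\<close>
  define R where "R = max 1 (1 + 2 * (g 0 - m) / \<mu>)"
  have far: "g 0 \<le> g v" if v: "norm v > R" for v
  proof -
    let ?r = "norm v"
    have r: "?r > 1" and r': "?r > 1 + 2 * (g 0 - m) / \<mu>"
      using v unfolding R_def by auto
    have "m \<le> g ((1 / ?r) *\<^sub>R v + (1 - 1 / ?r) *\<^sub>R 0)"
      using r by (intro m) auto
    also have "\<dots> \<le> 1 / ?r * g v + (1 - 1 / ?r) * g 0
        - \<mu> / 2 * (1 / ?r) * (1 - 1 / ?r) * (norm (v - 0))\<^sup>2"
      using r by (intro sc) (auto simp: divide_le_eq_1)
    also have "\<mu> / 2 * (1 / ?r) * (1 - 1 / ?r) * (norm (v - 0))\<^sup>2 = \<mu> / 2 * (?r - 1)"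
    proof -
      have "?r \<noteq> 0" using r by linarith
      then show ?thesis by (simp add: field_simps power2_eq_square del: norm_eq_zero)
    qed
    finally have "m \<le> 1 / ?r * g v + (1 - 1 / ?r) * g 0 - \<mu> / 2 * (?r - 1)" .
    moreover have "g 0 - m \<le> \<mu> / 2 * (?r - 1)"
      using r' \<mu> by (simp add: field_simps)
    moreover have "1 / ?r * g v + (1 - 1 / ?r) * g 0 = g 0 + 1 / ?r * (g v - g 0)"
      by (simp add: algebra_simps diff_divide_distrib)
    ultimately have "0 \<le> 1 / ?r * (g v - g 0)"
      by (smt (verit))
    then show ?thesis
      using r by (auto simp: zero_le_mult_iff zero_le_divide_iff)
  qed
  have "\<exists>v\<in>cball 0 R. \<forall>w\<in>cball 0 R. g v \<le> g w"
    by (rule continuous_attains_inf) (auto simp: R_def intro: continuous_on_subset[OF cont])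
  then obtain v where v: "\<And>w. norm w \<le> R \<Longrightarrow> g v \<le> g w"
    by (metis mem_cball_0)
  \<comment> \<open>This puts the origin in the ball, so \<open>g v \<le> g 0\<close>, and
    \<open>far\<close> extends the minimality of \<open>v\<close> beyond the ball.\<close>
  moreover have "0 \<le> R"
    by (simp add: R_def)
  ultimately have "g v \<le> g w" for w
    using far[of w] by (metis norm_zero not_le order_trans)
  then show ?thesis ..
qed

text \<open>Comparing with the midpoint of \<open>v\<close> and \<open>w\<close> loses a factor 2 in the constant, but needs no limit.\<close>

lemma strongly_convex_quadratic_growth:
  assumes "strongly_convex g"
  obtains \<mu> where "\<mu> > 0"
    and "\<And>v w. (\<And>u. g v \<le> g u) \<Longrightarrow> g v + \<mu> * (norm (w - v))\<^sup>2 \<le> g w"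
proof -
  from assms obtain \<mu> where \<mu>: "\<mu> > 0" and sc: "\<And>v w s. s \<in> {0..1} \<Longrightarrow>
      g (s *\<^sub>R v + (1 - s) *\<^sub>R w) \<le> s * g v + (1 - s) * g w - \<mu> / 2 * s * (1 - s) * (norm (v - w))\<^sup>2"
    unfolding strongly_convex_def by blast
  have "g v + \<mu> / 4 * (norm (w - v))\<^sup>2 \<le> g w" if v: "\<And>u. g v \<le> g u" for v w
  proof -
    have "g v \<le> g ((1 / 2) *\<^sub>R w + (1 - 1 / 2) *\<^sub>R v)"
      by (rule v)
    also have "\<dots> \<le> 1 / 2 * g w + (1 - 1 / 2) * g v - \<mu> / 2 * (1 / 2) * (1 - 1 / 2) * (norm (w - v))\<^sup>2"
      by (rule sc) simp
    finally show ?thesis by simp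
  qed
  with \<mu> show ?thesis by (intro that[of "\<mu> / 4"]) auto
qed

section \<open>The Hamiltonian and its gradient\<close>

lemma GDERIV_quadratic_boundI:
  fixes u :: "'a::real_inner \<Rightarrow> real"
  assumes "\<And>q. \<bar>u q - u p - (q - p) \<bullet> D\<bar> \<le> C * (norm (q - p))\<^sup>2"
  shows "GDERIV u p :> D"
  unfolding gderiv_def has_derivative_at
proof
  show "bounded_linear (\<lambda>h. h \<bullet> D)"
    by (rule bounded_linear_inner_left)
  have lim: "((\<lambda>h::'a. C * norm h) \<longlongrightarrow> 0) (at 0)"
    by (intro tendsto_mult_right_zero tendsto_norm_zero tendsto_ident_at)
  have "norm (norm (u (p + h) - u p - h \<bullet> D) / norm h) \<le> C * norm h" if "h \<noteq> 0" for h
    using assms[of "p + h"] that by (simp add: field_simps power2_eq_square)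
  then show "((\<lambda>h. norm (u (p + h) - u p - h \<bullet> D) / norm h) \<longlongrightarrow> 0) (at 0)"
    by (intro Lim_null_comparison[OF _ lim]) (simp add: eventually_at_filter)
qed

lemma hamiltonian_eq_of_max:
  assumes "\<And>w. w \<bullet> p - L t x w \<le> v \<bullet> p - L t x v"
  shows "hamiltonian L t x p = v \<bullet> p - L t x v"
  unfolding hamiltonian_def using assms by (intro cSup_eq_maximum) auto

text \<open>Attainment also shows that the real-valued \<open>SUP\<close> in
  \<open>hamiltonian\<close> is a true maximum and not an unspecified value.\<close>

lemma strongly_convex_hamiltonian_attained:
  assumes "strongly_convex (L t x)"
  obtains v where "\<And>w. w \<bullet> p - L t x w \<le> v \<bullet> p - L t x v"
    and "hamiltonian L t x p = v \<bullet> p - L t x v"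
proof -
  obtain v where "\<And>w. L t x v - v \<bullet> p \<le> L t x w - w \<bullet> p"
    using strongly_convex_attains_min[OF strongly_convex_diff_inner[OF assms]] by metis
  then have max: "w \<bullet> p - L t x w \<le> v \<bullet> p - L t x v" for w
    by (smt (verit))
  show ?thesis
    using that[OF max hamiltonian_eq_of_max[of p L t x, OF max]] .
qed

lemma hamiltonian_legendre:
  assumes sc: "strongly_convex (L t x)"
  shows "hamiltonian L t x p = DpH L t x p \<bullet> p - L t x (DpH L t x p)"
proof -
  let ?H = "hamiltonian L t x"
  obtain v where max: "\<And>w. w \<bullet> p - L t x w \<le> v \<bullet> p - L t x v"
    and Hp: "?H p = v \<bullet> p - L t x v"
    using strongly_convex_hamiltonian_attained[of L t x, OF sc] by metis
  obtain \<mu> where \<mu>: "\<mu> > 0" and growth: "\<And>v w.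
      (\<And>u. L t x v - v \<bullet> p \<le> L t x u - u \<bullet> p) \<Longrightarrow>
      L t x v - v \<bullet> p + \<mu> * (norm (w - v))\<^sup>2 \<le> L t x w - w \<bullet> p"
    using strongly_convex_quadratic_growth[OF strongly_convex_diff_inner[OF sc, of p]] by metis
  have growth_v: "L t x v - v \<bullet> p + \<mu> * (norm (w - v))\<^sup>2 \<le> L t x w - w \<bullet> p" for w
    by (rule growth) (use max in \<open>smt (verit)\<close>)
  have "\<bar>?H q - ?H p - (q - p) \<bullet> v\<bar> \<le> (1 / (4 * \<mu>)) * (norm (q - p))\<^sup>2" for q
  proof -
    obtain w where maxq: "\<And>u. u \<bullet> q - L t x u \<le> w \<bullet> q - L t x w"
      and Hq: "?H q = w \<bullet> q - L t x w"
      using strongly_convex_hamiltonian_attained[of L t x, OF sc] by metis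
    have "(w - v) \<bullet> (q - p) \<le> norm (w - v) * norm (q - p)"
      by (rule norm_cauchy_schwarz)
    \<comment> \<open>Young's inequality, weighted so that its first term is exactly what the
      quadratic growth at \<open>v\<close> absorbs.\<close>
    also have "\<dots> \<le> \<mu> * (norm (w - v))\<^sup>2 + 1 / (4 * \<mu>) * (norm (q - p))\<^sup>2"
    proof -
      have "0 \<le> (2 * \<mu> * norm (w - v) - norm (q - p))\<^sup>2 / (4 * \<mu>)"
        using \<mu> by simp
      also have "\<dots> = \<mu> * (norm (w - v))\<^sup>2 + 1 / (4 * \<mu>) * (norm (q - p))\<^sup>2
          - norm (w - v) * norm (q - p)"
        using \<mu> by (simp add: field_simps power2_eq_square)
      finally show ?thesis by simp
    qed
    finally have "?H q - ?H p - (q - p) \<bullet> v \<le> 1 / (4 * \<mu>) * (norm (q - p))\<^sup>2"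
      using growth_v[of w] unfolding Hp Hq by (simp add: inner_commute inner_diff_left inner_diff_right)
    \<comment> \<open>The maximiser \<open>v\<close> for \<open>p\<close> is a competitor in the
      supremum for \<open>q\<close>.\<close>
    moreover have "0 \<le> ?H q - ?H p - (q - p) \<bullet> v"
      using maxq[of v] unfolding Hp Hq by (simp add: inner_commute inner_diff_left inner_diff_right)
    ultimately show ?thesis by simp
  qed
  \<comment> \<open>Neither \<open>v\<close> nor \<mu> depends on \<open>q\<close>, so the bound is
    a first-order expansion of the Hamiltonian at \<open>p\<close>.\<close>
  then have "DpH L t x p = v"
    unfolding DpH_def by (intro grad_eqI GDERIV_quadratic_boundI)
  with Hp show ?thesis by simp
qed

section \<open>Differentiation along a path\<close>

text \<open>\<open>C12\<close> provides separate derivatives in time and space; joint continuity of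
  the spatial gradient upgrades them to a joint derivative on the closed time strip, which is then
  composed with \<open>s \<mapsto> (s, X s)\<close>. Derivatives within \<open>{0..T}\<close> cover
  the one-sided end points.\<close>

lemma C12_chain_rule:
  assumes u: "C12 T u" and t: "t \<in> {0..T}"
    and X: "(X has_vector_derivative X') (at t within {0..T})"
  shows "((\<lambda>s. u s (X s)) has_real_derivative time_deriv T u t (X t) + X' \<bullet> grad (u t) (X t))
           (at t within {0..T})"
proof -
  \<comment> \<open>The gradient is packaged as a bounded linear functional because the criterion
    for joint differentiability asks for a continuous operator-valued partial derivative.\<close>
  let ?G = "\<lambda>s \<xi>. blinfun_inner_left (grad (u s) \<xi>)"
  have time: "((\<lambda>s. u s (X t)) has_derivative (\<lambda>h. h * time_deriv T u t (X t))) (at t within {0..T})"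
    using u t vector_derivative_works[of "\<lambda>s. u s (X t)" "at t within {0..T}"]
    unfolding C12_def time_deriv_def has_vector_derivative_def by simp
  have space: "(u s has_derivative blinfun_apply (?G s \<xi>)) (at \<xi> within UNIV)" if "s \<in> {0..T}" for s \<xi>
    using GDERIV_grad[of "u s" \<xi>] u that unfolding C12_def gderiv_def by (simp add: inner_commute)
  have "continuous_on ({0..T} \<times> UNIV) (\<lambda>(s, \<xi>). ?G s \<xi>)"
    using u unfolding C12_def case_prod_beta
    by (auto intro!: bounded_linear.continuous_on[OF bounded_linear_blinfun_inner_left])
  then have cont: "continuous (at (t, X t) within {0..T} \<times> UNIV) (\<lambda>(s, \<xi>). ?G s \<xi>)"
    using t by (auto simp: continuous_on_eq_continuous_within)
  have "((\<lambda>(s, \<xi>). u s \<xi>) has_derivative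
      (\<lambda>(a, b). a * time_deriv T u t (X t) + blinfun_apply (?G t (X t)) b))
      (at (t, X t) within {0..T} \<times> UNIV)"
    by (rule has_derivative_partialsI[OF time space cont]) auto
  \<comment> \<open>Restricting to the graph of the path gives the form that the chain rule for
    derivatives within a set takes.\<close>
  then have joint: "((\<lambda>(s, \<xi>). u s \<xi>) has_derivative
      (\<lambda>(a, b). a * time_deriv T u t (X t) + blinfun_apply (?G t (X t)) b))
      (at (t, X t) within (\<lambda>s. (s, X s)) ` {0..T})"
    by (rule has_derivative_subset) auto
  have "((\<lambda>s. (s, X s)) has_derivative (\<lambda>h. (h, h *\<^sub>R X'))) (at t within {0..T})"
    using X unfolding has_vector_derivative_def by (intro derivative_intros)
  from has_derivative_in_compose[OF this joint] show ?thesis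
    unfolding has_real_derivative_iff_has_vector_derivative has_vector_derivative_def
    by (simp add: algebra_simps inner_commute)
qed

theorem proposition2:
  fixes T \<beta> :: real
    and L :: "real \<Rightarrow> real ^ 'd \<Rightarrow> real ^ 'd \<Rightarrow> real"
    and F f :: "real \<Rightarrow> real ^ 'd \<Rightarrow> real \<Rightarrow> real"
    and V \<rho>0 :: "real ^ 'd \<Rightarrow> real"
    and \<rho> \<phi> :: "real \<Rightarrow> real ^ 'd \<Rightarrow> real"
    and M :: "'w measure"
    and x z :: "real \<Rightarrow> 'w \<Rightarrow> real ^ 'd"
    and y ft h :: "real \<Rightarrow> 'w \<Rightarrow> real"
  assumes "T > 0" and "\<beta> > 0"
    and "\<And>t \<xi>. strongly_convex (L t \<xi>)"
    and "\<And>t \<xi> r. (F t \<xi> has_field_derivative f t \<xi> r) (at r)"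
    and "\<rho>0 \<in> borel_measurable borel" and "\<And>\<xi>. 0 \<le> \<rho>0 \<xi>"
    and "prob_space (density lborel (\<lambda>\<xi>. ennreal (\<rho>0 \<xi>)))"
    and "mfg_solution T \<beta> L f V \<rho>0 \<rho> \<phi>"
    and "prob_space M"
    and "probability_flow M T \<beta> L \<rho>0 \<rho> \<phi> x"
    and "\<And>t \<omega>. y t \<omega> = \<phi> t (x t \<omega>)"
    and "\<And>t \<omega>. ft t \<omega> = f t (x t \<omega>) (\<rho> t (x t \<omega>))"
    and "\<And>t \<omega>. z t \<omega> = grad (\<phi> t) (x t \<omega>)"
    and "\<And>t \<omega>. h t \<omega> = laplacian (\<phi> t) (x t \<omega>)"
  shows "(AE \<omega> in M. \<forall>t\<in>{0..T}.
            0 < \<rho> t (x t \<omega>)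
          \<and> ((\<lambda>s. x s \<omega>) has_vector_derivative
               DpH L t (x t \<omega>) (z t \<omega>)
                 - (1 / \<beta>) *\<^sub>R grad (\<lambda>\<xi>. ln (\<rho> t \<xi>)) (x t \<omega>)) (at t within {0..T})
          \<and> ((\<lambda>s. y s \<omega>) has_real_derivative
               L t (x t \<omega>) (DpH L t (x t \<omega>) (z t \<omega>)) + ft t \<omega> - 1 / \<beta> * h t \<omega>
                 - 1 / \<beta> * (z t \<omega> \<bullet> grad (\<lambda>\<xi>. ln (\<rho> t \<xi>)) (x t \<omega>))) (at t within {0..T}))
       \<and> random_start M T \<rho>0 x
       \<and> (\<forall>\<omega>\<in>space M. y T \<omega> = - V (x T \<omega>))"
proof -
  note sc = assms(3) and sol = assms(8) and flow = assms(10)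
  note y = assms(11) and ft = assms(12) and z = assms(13) and h = assms(14)
  have HJB: "time_deriv T \<phi> t \<xi> = f t \<xi> (\<rho> t \<xi>) - hamiltonian L t \<xi> (grad (\<phi> t) \<xi>)
      - 1 / \<beta> * laplacian (\<phi> t) \<xi>" if "t \<in> {0..T}" for t \<xi>
    using sol that unfolding mfg_solution_def by (smt (verit))
  have \<phi>: "C12 T \<phi>" and terminal: "\<And>\<xi>. \<phi> T \<xi> = - V \<xi>"
    using sol unfolding mfg_solution_def by auto
  \<comment> \<open>This is a deterministic statement about a single path and time, so the backward
    equation holds outside the same null set as the flow equation.\<close>
  have y': "((\<lambda>s. y s \<omega>) has_real_derivative
      L t (x t \<omega>) (DpH L t (x t \<omega>) (z t \<omega>)) + ft t \<omega> - 1 / \<beta> * h t \<omega>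
        - 1 / \<beta> * (z t \<omega> \<bullet> grad (\<lambda>\<xi>. ln (\<rho> t \<xi>)) (x t \<omega>))) (at t within {0..T})"
    (is "(_ has_real_derivative ?R) _")
    if t: "t \<in> {0..T}" and x: "((\<lambda>s. x s \<omega>) has_vector_derivative
      DpH L t (x t \<omega>) (z t \<omega>)
        - (1 / \<beta>) *\<^sub>R grad (\<lambda>\<xi>. ln (\<rho> t \<xi>)) (x t \<omega>)) (at t within {0..T})" for t \<omega>
  proof -
    let ?v = "DpH L t (x t \<omega>) (z t \<omega>)" and ?s = "grad (\<lambda>\<xi>. ln (\<rho> t \<xi>)) (x t \<omega>)"
    have "hamiltonian L t (x t \<omega>) (z t \<omega>) = ?v \<bullet> z t \<omega> - L t (x t \<omega>) ?v"
      by (rule hamiltonian_legendre) (rule sc)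
    \<comment> \<open>After the Hamilton-Jacobi-Bellman equation is inserted,
      \<open>?v \<bullet> z t \<omega>\<close> minus the Hamiltonian collapses to the Lagrangian;
      the score term of the velocity, paired with \<open>z t \<omega>\<close>, is the last term of
      \<open>?R\<close>.\<close>
    then have "time_deriv T \<phi> t (x t \<omega>) + (?v - (1 / \<beta>) *\<^sub>R ?s) \<bullet> z t \<omega> = ?R"
      using HJB[OF t, of "x t \<omega>", folded z h ft]
      by (simp add: inner_diff_left inner_commute[of ?s])
    then show ?thesis
      using C12_chain_rule[OF \<phi> t x, folded z y] by (simp only:)
  qed
  have start: "random_start M T \<rho>0 x" and ode: "AE \<omega> in M. \<forall>t\<in>{0..T}. 0 < \<rho> t (x t \<omega>)
      \<and> ((\<lambda>s. x s \<omega>) has_vector_derivative DpH L t (x t \<omega>) (z t \<omega>)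
        - (1 / \<beta>) *\<^sub>R grad (\<lambda>\<xi>. ln (\<rho> t \<xi>)) (x t \<omega>)) (at t within {0..T})"
    using flow unfolding probability_flow_def z by (rule conjunct1, rule conjunct2)
  show ?thesis
  proof (intro conjI ballI)
    show "AE \<omega> in M. \<forall>t\<in>{0..T}.
            0 < \<rho> t (x t \<omega>)
          \<and> ((\<lambda>s. x s \<omega>) has_vector_derivative
               DpH L t (x t \<omega>) (z t \<omega>)
                 - (1 / \<beta>) *\<^sub>R grad (\<lambda>\<xi>. ln (\<rho> t \<xi>)) (x t \<omega>)) (at t within {0..T})
          \<and> ((\<lambda>s. y s \<omega>) has_real_derivative
               L t (x t \<omega>) (DpH L t (x t \<omega>) (z t \<omega>)) + ft t \<omega> - 1 / \<beta> * h t \<omega>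
                 - 1 / \<beta> * (z t \<omega> \<bullet> grad (\<lambda>\<xi>. ln (\<rho> t \<xi>)) (x t \<omega>))) (at t within {0..T})"
      using ode by (rule eventually_mono) (use y' in blast)
  qed (simp_all only: start y terminal)
qed

end
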